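(* For every $n\ge 1$, the $n\times n$ minor (the determinant) of an $n\times n$ symmetric matrix of indeterminates forms a tropical basis; i.e., a real symmetric $n\times n$ matrix $A$ is symmetrically tropically singular if and only if $A$ has a singular symmetric lift.
   Context: Let $\tilde K$ be the field of Hahn series $\sum_{\alpha\in A}c_\alpha t^\alpha$ ($A\subset\mathbb R$ well-ordered, $c_\alpha\in\mathbb C$); for nonzero $a\in\tilde K$, $\deg(a)$ is the smallest exponent with nonzero coefficient. A symmetric lift of a real symmetric $n\times n$ matrix $A$ is a symmetric matrix $\tilde A$ over $\tilde K$ with all entries nonzero and $\deg(\tilde a_{i,j})=A_{i,j}$. $A$ is symmetrically tropically singular if, among the monomials $\prod_i X_{i,\sigma(i)}$ ($\sigma\in S_n$) in commuting variables subject to $X_{i,j}=X_{j,i}$, with value $\sum_i A_{i,\sigma(i)}$, the minimum value is attained by at least two distinct monomials. The minors form a tropical basis means the tropical prevariety of their tropicalizations equals the tropicalization (image under coordinatewise $\deg$) of the variety they define in nonzero coordinates. *)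

theory Defs
  imports Complex_Main "HOL-Combinatorics.Permutations" "HOL-Library.Multiset"
begin

text \<open>Hahn series sum c_a t^a (a real, c_a complex) represented by their
coefficient function real => complex; the field K~ consists of those with
well-ordered support.\<close>

definition hahn_supp :: "(real \<Rightarrow> complex) \<Rightarrow> real set" where
  "hahn_supp f = {a. f a \<noteq> 0}"

definition is_hahn :: "(real \<Rightarrow> complex) \<Rightarrow> bool" where
  "is_hahn f \<longleftrightarrow> (\<forall>S. S \<subseteq> hahn_supp f \<longrightarrow> S \<noteq> {} \<longrightarrow> (\<exists>m\<in>S. \<forall>x\<in>S. m \<le> x))"

definition hahn_zero :: "real \<Rightarrow> complex" where
  "hahn_zero = (\<lambda>_. 0)"

definition hahn_one :: "real \<Rightarrow> complex" where
  "hahn_one = (\<lambda>a. if a = 0 then 1 else 0)"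

text \<open>Product (Cauchy convolution); for well-ordered supports the index set is finite.\<close>
definition hahn_mult :: "(real \<Rightarrow> complex) \<Rightarrow> (real \<Rightarrow> complex) \<Rightarrow> (real \<Rightarrow> complex)" where
  "hahn_mult f g = (\<lambda>c. \<Sum>(a,b)\<in>{(a,b). f a \<noteq> 0 \<and> g b \<noteq> 0 \<and> a + b = c}. f a * g b)"

definition hahn_deg :: "(real \<Rightarrow> complex) \<Rightarrow> real" where
  "hahn_deg f = (THE m. f m \<noteq> 0 \<and> (\<forall>x. f x \<noteq> 0 \<longrightarrow> m \<le> x))"

fun hahn_diag_prod :: "(nat \<Rightarrow> nat \<Rightarrow> (real \<Rightarrow> complex)) \<Rightarrow> (nat \<Rightarrow> nat) \<Rightarrow> nat \<Rightarrow> (real \<Rightarrow> complex)" where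
  "hahn_diag_prod M \<sigma> 0 = hahn_one"
| "hahn_diag_prod M \<sigma> (Suc k) = hahn_mult (hahn_diag_prod M \<sigma> k) (M k (\<sigma> k))"

definition hahn_det :: "nat \<Rightarrow> (nat \<Rightarrow> nat \<Rightarrow> (real \<Rightarrow> complex)) \<Rightarrow> (real \<Rightarrow> complex)" where
  "hahn_det n M = (\<lambda>c. \<Sum>\<sigma>\<in>{\<sigma>. \<sigma> permutes {..<n}}. of_int (sign \<sigma>) * hahn_diag_prod M \<sigma> n c)"

definition sym_real_matrix :: "nat \<Rightarrow> (nat \<Rightarrow> nat \<Rightarrow> real) \<Rightarrow> bool" where
  "sym_real_matrix n A \<longleftrightarrow> (\<forall>i<n. \<forall>j<n. A i j = A j i)"

definition symmetric_lift :: "nat \<Rightarrow> (nat \<Rightarrow> nat \<Rightarrow> real) \<Rightarrow> (nat \<Rightarrow> nat \<Rightarrow> (real \<Rightarrow> complex)) \<Rightarrow> bool" where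
  "symmetric_lift n A L \<longleftrightarrow>
     (\<forall>i<n. \<forall>j<n. is_hahn (L i j) \<and> L i j \<noteq> hahn_zero \<and> L i j = L j i \<and> hahn_deg (L i j) = A i j)"

text \<open>The monomial prod_i X_{i,sigma(i)} with X_{i,j} = X_{j,i}: the multiset of
unordered index pairs, each pair normalised as (min, max).\<close>
definition sym_monomial :: "nat \<Rightarrow> (nat \<Rightarrow> nat) \<Rightarrow> (nat \<times> nat) multiset" where
  "sym_monomial n \<sigma> = mset (map (\<lambda>i. (min i (\<sigma> i), max i (\<sigma> i))) [0..<n])"

definition perm_value :: "nat \<Rightarrow> (nat \<Rightarrow> nat \<Rightarrow> real) \<Rightarrow> (nat \<Rightarrow> nat) \<Rightarrow> real" where
  "perm_value n A \<sigma> = (\<Sum>i<n. A i (\<sigma> i))"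

definition sym_trop_singular :: "nat \<Rightarrow> (nat \<Rightarrow> nat \<Rightarrow> real) \<Rightarrow> bool" where
  "sym_trop_singular n A \<longleftrightarrow>
     (\<exists>\<sigma> \<tau>. \<sigma> permutes {..<n} \<and> \<tau> permutes {..<n} \<and>
        sym_monomial n \<sigma> \<noteq> sym_monomial n \<tau> \<and>
        (\<forall>\<rho>. \<rho> permutes {..<n} \<longrightarrow> perm_value n A \<sigma> \<le> perm_value n A \<rho>) \<and>
        (\<forall>\<rho>. \<rho> permutes {..<n} \<longrightarrow> perm_value n A \<tau> \<le> perm_value n A \<rho>))"

end

theory Submission
  imports Defs "HOL-Computational_Algebra.Polynomial"
begin

text \<open>
  A permutation is determined by its monomial up to reversing cycles, so all permutations with the
  same monomial have the same sign and their contributions to the determinant cannot cancel. Hence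
  if the minimum is attained by a single monomial, the leading coefficient of the determinant of
  every lift is nonzero.

  Conversely, let two minimal monomials differ in the exponent of the variable \<open>x = X\<^sub>e\<close>. As a
  polynomial in \<open>x\<close> the determinant has degree at most 2. For generic complex coefficients in the
  other entries \<open>c t\<^sup>A\<close>, its coefficients have exactly the degrees predicted tropically, so two of
  the three terms have the same minimal degree at \<open>deg x = A\<^sub>e\<close>. The quadratic formula then yields
  a root of that degree, since one can take square roots of series with locally finite support.
\<close>

section \<open>Monomials of permutations\<close>

text \<open>The index of the variable \<open>X_{i,j} = X_{j,i}\<close>, normalised as in
  \<open>sym_monomial\<close>.\<close>

definition edge :: "nat \<Rightarrow> nat \<Rightarrow> nat \<times> nat" where
  "edge i j = (min i j, max i j)"

text \<open>The monomial of \<open>\<sigma>\<close>, seen as the undirected multigraph of its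
  cycles: a fixed point gives a loop and a 2-cycle a double edge.\<close>

definition edges :: "nat set \<Rightarrow> (nat \<Rightarrow> nat) \<Rightarrow> (nat \<times> nat) multiset" where
  "edges S \<sigma> = image_mset (\<lambda>i. edge i (\<sigma> i)) (mset_set S)"

lemma edge_commute: "edge i j = edge j i"
  by (simp add: edge_def min.commute max.commute)

lemma edge_eq_iff: "edge i j = edge k l \<longleftrightarrow> i = k \<and> j = l \<or> i = l \<and> j = k"
  by (auto simp: edge_def min_def max_def)

lemma sym_monomial_eq_edges: "sym_monomial n \<sigma> = edges {..<n} \<sigma>"
  by (simp add: sym_monomial_def edges_def edge_def mset_upt lessThan_atLeast0)

text \<open>A product of symmetric quantities along a permutation depends only on its
  monomial.\<close>

lemma prod_eq_prod_edges: "(\<Prod>i\<in>S. h (edge i (\<sigma> i))) = prod_mset (image_mset h (edges S \<sigma>))"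
  by (simp add: edges_def prod_unfold_prod_mset multiset.map_comp comp_def)

lemma sum_eq_sum_edges: "(\<Sum>i\<in>S. h (edge i (\<sigma> i))) = sum_mset (image_mset h (edges S \<sigma>))"
  by (simp add: edges_def sum_unfold_sum_mset multiset.map_comp comp_def)

text \<open>Inversion reverses every cycle, which undirected edges do not see.\<close>

lemma edges_inv:
  assumes "\<sigma> permutes S"
  shows "edges S (inv \<sigma>) = edges S \<sigma>"
proof -
  have "edges S (inv \<sigma>) = image_mset (\<lambda>i. edge i (inv \<sigma> i)) (image_mset \<sigma> (mset_set S))"
    using assms by (simp add: edges_def image_mset_mset_set permutes_inj_on permutes_image)
  also have "\<dots> = edges S \<sigma>"
    unfolding edges_def multiset.map_comp comp_def
    using permutes_inverses(2)[OF assms] by (simp add: edge_commute)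
  finally show ?thesis .
qed

lemma edges_remove2:
  assumes "finite S" "i \<in> S" "k \<in> S" "i \<noteq> k"
  shows "edges S f = {#edge i (f i), edge k (f k)#} + edges (S - {i, k}) f"
proof -
  have "mset_set S = add_mset i (mset_set (S - {i}))"
    using assms by (simp add: mset_set.remove)
  also have "mset_set (S - {i}) = add_mset k (mset_set (S - {i} - {k}))"
    using assms by (intro mset_set.remove) auto
  also have "S - {i} - {k} = S - {i, k}" by blast
  finally show ?thesis by (simp add: edges_def)
qed

lemma permutes_inv_moved:
  assumes "\<sigma> permutes S" "i \<in> S" "\<sigma> i \<noteq> i"
  shows "\<sigma> (inv \<sigma> i) = i" "inv \<sigma> i \<in> S" "i \<noteq> inv \<sigma> i"
proof -
  show k: "\<sigma> (inv \<sigma> i) = i"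
    using permutes_inverses(1)[OF assms(1)] .
  then show "i \<noteq> inv \<sigma> i" using assms(3) by metis
  show "inv \<sigma> i \<in> S"
    using assms(1,2) by (meson permutes_in_image permutes_inv)
qed

lemma edges_split:
  assumes "finite S" "\<sigma> permutes S" "i \<in> S" "\<sigma> i \<noteq> i"
  shows "edges S \<sigma> = {#edge i (\<sigma> i), edge (inv \<sigma> i) i#} + edges (S - {i, inv \<sigma> i}) \<sigma>"
  using edges_remove2[OF assms(1,3), of "inv \<sigma> i" \<sigma>] permutes_inv_moved[OF assms(2-)] by simp

text \<open>A moved point lies on exactly two edges, counted with multiplicity: one leaves it and
  one enters it. The monomial therefore fixes both neighbours of \<open>i\<close>, and knowing one
  of them gives the other.\<close>

lemma edges_at_vertex:
  assumes "finite S" "\<sigma> permutes S" "i \<in> S" "\<sigma> i \<noteq> i"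
  shows "filter_mset (\<lambda>(a, b). a = i \<or> b = i) (edges S \<sigma>) = {#edge i (\<sigma> i), edge (inv \<sigma> i) i#}"
proof -
  have "\<not> (case edge x (\<sigma> x) of (a, b) \<Rightarrow> a = i \<or> b = i)" if "x \<in> S - {i, inv \<sigma> i}" for x
    using that permutes_inverses(2)[OF assms(2)] by (auto simp: edge_def min_def max_def)
  then have "filter_mset (\<lambda>(a, b). a = i \<or> b = i) (edges (S - {i, inv \<sigma> i}) \<sigma>) = {#}"
    using assms(1) unfolding edges_def filter_mset_eq_mempty_iff by (metis (no_types, lifting)
        finite_Diff finite_set_mset_mset_set in_image_mset imageE)
  moreover have "case edge i j of (a, b) \<Rightarrow> a = i \<or> b = i" "case edge j i of (a, b) \<Rightarrow> a = i \<or> b = i" for j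
    by (auto simp: edge_def min_def max_def)
  ultimately show ?thesis
    by (simp add: edges_split[OF assms])
qed

text \<open>Composing with the transposition cuts \<open>i\<close> out of its cycle:
  \<open>i\<close> becomes fixed, its preimage is sent straight to \<open>\<sigma> i\<close>, and
  nothing else changes. For a 2-cycle the new edge is a loop.\<close>

lemma edges_contract:
  assumes "finite S" "\<sigma> permutes S" "i \<in> S" "\<sigma> i \<noteq> i"
  shows "edges S (transpose i (\<sigma> i) \<circ> \<sigma>) =
    {#edge i i, edge (inv \<sigma> i) (\<sigma> i)#} + (edges S \<sigma> - {#edge i (\<sigma> i), edge (inv \<sigma> i) i#})"
proof -
  let ?s = "transpose i (\<sigma> i) \<circ> \<sigma>" and ?k = "inv \<sigma> i"
  note k = permutes_inv_moved[OF assms(2-)]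
  have "edges S ?s = {#edge i i, edge ?k (\<sigma> i)#} + edges (S - {i, ?k}) ?s"
    using edges_remove2[OF assms(1,3) k(2,3), of ?s] k(1) by simp
  also have "edges (S - {i, ?k}) ?s = edges (S - {i, ?k}) \<sigma>"
  proof -
    have "?s x = \<sigma> x" if "x \<in> S - {i, ?k}" for x
    proof -
      have "\<sigma> x \<noteq> \<sigma> i" "\<sigma> x \<noteq> i"
        using that k(1) injD[OF permutes_inj[OF assms(2)], of x i]
          injD[OF permutes_inj[OF assms(2)], of x "inv \<sigma> i"] by auto
      then show ?thesis by (simp add: transpose_def)
    qed
    then show ?thesis
      unfolding edges_def by (intro image_mset_cong) (use assms(1) in auto)
  qed
  finally show ?thesis
    by (simp only: edges_split[OF assms] add_diff_cancel_left')
qed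

text \<open>Contracting an edge \<open>i \<rightarrow> \<sigma> i\<close> common to both permutations turns \<open>i\<close> into a fixed point, flips
  both signs, and preserves equality of the edge multisets because both permutations also share the
  other edge at \<open>i\<close>.\<close>

lemma sign_eq_if_edges_eq:
  assumes "finite S" "\<sigma> permutes S" "\<tau> permutes S" "edges S \<sigma> = edges S \<tau>"
  shows "sign \<sigma> = sign \<tau>"
  using assms(2-)
proof (induction "card {i \<in> S. \<sigma> i \<noteq> i}" arbitrary: \<sigma> \<tau> rule: less_induct)
  case less
  show ?case
  proof (cases "\<forall>i\<in>S. \<sigma> i = i")
    case True
    then have \<sigma>: "\<sigma> = id"
      using less.prems(1) by (auto simp: permutes_def fun_eq_iff)
    have "\<tau> i = i" if "i \<in> S" for i
    proof -
      have "edge i (\<tau> i) \<in># edges S \<sigma>"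
        using that less.prems(3) assms(1) by (auto simp: edges_def)
      then show ?thesis
        using \<sigma> assms(1) by (auto simp: edges_def edge_eq_iff)
    qed
    then have "\<tau> = id"
      using less.prems(2) by (auto simp: permutes_def fun_eq_iff)
    with \<sigma> show ?thesis by simp
  next
    case False
    then obtain i where i: "i \<in> S" "\<sigma> i \<noteq> i" by blast
    have common: "sign \<sigma> = sign \<rho>"
      if \<rho>: "\<rho> permutes S" "edges S \<sigma> = edges S \<rho>" "\<rho> i = \<sigma> i" for \<rho>
    proof -
      let ?t = "transpose i (\<sigma> i)"
      have "{#edge i (\<sigma> i), edge (inv \<sigma> i) i#} = {#edge i (\<rho> i), edge (inv \<rho> i) i#}"
        using edges_at_vertex[OF assms(1) less.prems(1) i] edges_at_vertex[OF assms(1) \<rho>(1) i(1)]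
          i(2) \<rho>(2,3) by simp
      then have k: "inv \<sigma> i = inv \<rho> i"
        using \<rho>(3) by (auto simp: edge_eq_iff)
      have eq: "edges S (?t \<circ> \<sigma>) = edges S (?t \<circ> \<rho>)"
        using edges_contract[OF assms(1) less.prems(1) i] edges_contract[OF assms(1) \<rho>(1) i(1)]
          i(2) \<rho>(2,3) k by simp
      have t: "?t permutes S"
        using i less.prems(1) by (simp add: permutes_in_image permutes_swap_id)
      have perm: "(?t \<circ> \<sigma>) permutes S" "(?t \<circ> \<rho>) permutes S"
        using t less.prems(1) \<rho>(1) by (auto intro: permutes_compose)
      have "(?t \<circ> \<sigma>) x = x" if "\<sigma> x = x" for x
        using that i(2) permutes_inj[OF less.prems(1)]
        by (auto simp: transpose_def dest: injD)
      moreover have "(?t \<circ> \<sigma>) i = i" by simp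
      ultimately have "{x \<in> S. (?t \<circ> \<sigma>) x \<noteq> x} \<subset> {x \<in> S. \<sigma> x \<noteq> x}"
        using i by blast
      then have "card {x \<in> S. (?t \<circ> \<sigma>) x \<noteq> x} < card {x \<in> S. \<sigma> x \<noteq> x}"
        using assms(1) by (intro psubset_card_mono) auto
      from less.hyps[OF this perm eq] show ?thesis
        using less.prems(1) \<rho>(1) t assms(1)
        by (simp add: sign_compose permutes_imp_permutation sign_swap_id split: if_splits)
    qed
    have "edge i (\<sigma> i) \<in># edges S \<tau>"
      using i(1) less.prems(3)[symmetric] assms(1) by (auto simp: edges_def)
    \<comment> \<open>\<open>\<tau>\<close> runs through the shared edge in one of two directions.
      In the opposite direction, \<open>inv \<tau>\<close> has the same edges and the same sign and
      agrees with \<open>\<sigma>\<close> at \<open>i\<close>.\<close>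
    then consider "\<tau> i = \<sigma> i" | "\<tau> (\<sigma> i) = i"
      using assms(1) by (auto simp: edges_def edge_eq_iff)
    then show ?thesis
    proof cases
      case 1
      with common less.prems(2,3) show ?thesis by blast
    next
      case 2
      then have "inv \<tau> i = \<sigma> i"
        using less.prems(2) permutes_inverses(2) by metis
      then have "sign \<sigma> = sign (inv \<tau>)"
        using less.prems by (intro common) (simp_all add: permutes_inv edges_inv)
      then show ?thesis
        using less.prems(2) assms(1) by (metis sign_inverse permutes_imp_permutation)
    qed
  qed
qed

text \<open>Kronecker substitution: reading the multiplicities as digits in base \<open>s + 1\<close>.\<close>

lemma ex_separating_weight:
  fixes X :: "'a set"
  assumes "finite X"
  shows "\<exists>N :: 'a \<Rightarrow> nat. inj_on (\<lambda>M. \<Sum>x\<in>#M. N x) {M. set_mset M \<subseteq> X \<and> size M \<le> s}"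
  using assms
proof (induction X rule: finite_induct)
  case empty
  then show ?case by (auto simp: inj_on_def)
next
  case (insert x X)
  then obtain N :: "'a \<Rightarrow> nat" where N: "inj_on (\<lambda>M. \<Sum>x\<in>#M. N x) {M. set_mset M \<subseteq> X \<and> size M \<le> s}"
    by blast
  \<comment> \<open>The multiplicity of \<open>x\<close> becomes the lowest digit. The size bound
    keeps it below the base \<open>s + 1\<close>, so it is recovered modulo \<open>s + 1\<close>,
    and the quotient is the weight of the remaining elements.\<close>
  define N' where "N' = (\<lambda>y. if y = x then 1 else (s + 1) * N y)"
  let ?r = "filter_mset (\<lambda>y. y \<noteq> x)"
  have split: "M = replicate_mset (count M x) x + ?r M" for M
    by (auto simp: multiset_eq_iff)
  have sum: "(\<Sum>y\<in>#M. N' y) = count M x + (s + 1) * (\<Sum>y\<in>#?r M. N y)" for M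
    by (induction M) (auto simp: N'_def algebra_simps)
  have "M = M'" if M: "set_mset M \<subseteq> insert x X" "size M \<le> s"
    and M': "set_mset M' \<subseteq> insert x X" "size M' \<le> s"
    and eq: "(\<Sum>y\<in>#M. N' y) = (\<Sum>y\<in>#M'. N' y)" for M M'
  proof -
    have small: "count M x < s + 1" "count M' x < s + 1"
      using M(2) M'(2) count_le_size[of M x] count_le_size[of M' x] by linarith+
    have e: "count M x + (s + 1) * (\<Sum>y\<in>#?r M. N y) = count M' x + (s + 1) * (\<Sum>y\<in>#?r M'. N y)"
      using eq by (simp add: sum)
    from arg_cong[OF e, of "\<lambda>a. a mod (s + 1)"] have c: "count M x = count M' x"
      using small by (simp only: mod_mult_self2 mod_less)
    with e have r: "(\<Sum>y\<in>#?r M. N y) = (\<Sum>y\<in>#?r M'. N y)"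
      by (metis add_left_cancel mult_cancel1 add_is_0 one_neq_zero)
    have "?r M = ?r M'"
    proof (rule inj_onD[OF N r])
      show "?r M \<in> {M. set_mset M \<subseteq> X \<and> size M \<le> s}"
        using M by (auto intro: order_trans[OF size_filter_mset_lesseq])
      show "?r M' \<in> {M. set_mset M \<subseteq> X \<and> size M \<le> s}"
        using M' by (auto intro: order_trans[OF size_filter_mset_lesseq])
    qed
    with c show ?thesis
      using split[of M] split[of M'] by simp
  qed
  then have "inj_on (\<lambda>M. \<Sum>y\<in>#M. N' y) {M. set_mset M \<subseteq> insert x X \<and> size M \<le> s}"
    by (intro inj_onI) auto
  then show ?case by blast
qed

section \<open>Leading terms of Hahn series\<close>

text \<open>Any finite box containing all contributing pairs may replace the index set. With
  \<open>a + b = c\<close> moved into the summand, the order of summation can be exchanged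
  freely.\<close>

lemma hahn_mult_eq_sum:
  assumes "finite F" "finite G"
    and "\<And>a b. f a \<noteq> 0 \<Longrightarrow> g b \<noteq> 0 \<Longrightarrow> a + b = c \<Longrightarrow> a \<in> F \<and> b \<in> G"
  shows "hahn_mult f g c = (\<Sum>a\<in>F. \<Sum>b\<in>G. if a + b = c then f a * g b else 0)"
proof -
  have "(\<Sum>a\<in>F. \<Sum>b\<in>G. if a + b = c then f a * g b else 0)
      = (\<Sum>(a,b)\<in>F \<times> G. if a + b = c then f a * g b else 0)"
    by (simp add: sum.cartesian_product)
  also have "\<dots> = (\<Sum>(a,b)\<in>{(a,b). f a \<noteq> 0 \<and> g b \<noteq> 0 \<and> a + b = c}. f a * g b)"
    using assms by (intro sum.mono_neutral_cong_right) (auto split: if_splits)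
  finally show ?thesis by (simp add: hahn_mult_def)
qed

text \<open>A valuation bound that also makes sense for the zero series, where
  \<open>hahn_deg\<close> is meaningless.\<close>

definition deg_ge :: "(real \<Rightarrow> complex) \<Rightarrow> real \<Rightarrow> bool" where
  "deg_ge f c \<longleftrightarrow> (\<forall>x<c. f x = 0)"

lemma deg_ge_mono: "deg_ge f c \<Longrightarrow> d \<le> c \<Longrightarrow> deg_ge f d"
  by (auto simp: deg_ge_def)

text \<open>Below \<open>c + d\<close> no pair of exponents contributes to the product, and at
  \<open>c + d\<close> only the pair \<open>(c, d)\<close> can.\<close>

lemma deg_ge_hahn_mult:
  assumes "deg_ge f c" "deg_ge g d"
  shows "deg_ge (hahn_mult f g) (c + d)" "hahn_mult f g (c + d) = f c * g d"
proof -
  have le: "c \<le> a \<and> d \<le> b" if "f a \<noteq> 0" "g b \<noteq> 0" for a b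
    using assms that by (force simp: deg_ge_def not_less[symmetric])
  have "hahn_mult f g x = (\<Sum>a\<in>{}. \<Sum>b\<in>{}. if a + b = x then f a * g b else 0)" if "x < c + d" for x
    by (rule hahn_mult_eq_sum) (use le that in \<open>fastforce+\<close>)
  then show "deg_ge (hahn_mult f g) (c + d)" by (simp add: deg_ge_def)
  have "hahn_mult f g (c + d) = (\<Sum>a\<in>{c}. \<Sum>b\<in>{d}. if a + b = c + d then f a * g b else 0)"
    by (rule hahn_mult_eq_sum) (use le in \<open>fastforce+\<close>)
  then show "hahn_mult f g (c + d) = f c * g d" by simp
qed

lemma hahn_deg_eqI:
  assumes "deg_ge f d" "f d \<noteq> 0"
  shows "hahn_deg f = d"
  unfolding hahn_deg_def
proof (rule the_equality)
  show *: "f d \<noteq> 0 \<and> (\<forall>x. f x \<noteq> 0 \<longrightarrow> d \<le> x)"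
    using assms by (force simp: deg_ge_def)
  fix m assume "f m \<noteq> 0 \<and> (\<forall>x. f x \<noteq> 0 \<longrightarrow> m \<le> x)"
  with * show "m = d" by (intro antisym) auto
qed

lemma hahn_deg_leading:
  assumes "is_hahn f" "f \<noteq> hahn_zero"
  shows "deg_ge f (hahn_deg f)" "f (hahn_deg f) \<noteq> 0"
proof -
  have "hahn_supp f \<noteq> {}"
    using assms(2) by (auto simp: hahn_supp_def hahn_zero_def)
  then obtain m where m: "m \<in> hahn_supp f" "\<forall>x\<in>hahn_supp f. m \<le> x"
    using assms(1) unfolding is_hahn_def by blast
  then have *: "deg_ge f m" "f m \<noteq> 0"
    by (force simp: deg_ge_def hahn_supp_def)+
  then have "hahn_deg f = m" by (rule hahn_deg_eqI)
  with * show "deg_ge f (hahn_deg f)" "f (hahn_deg f) \<noteq> 0" by simp_all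
qed

lemma hahn_diag_prod_leading:
  assumes "\<And>i. i < k \<Longrightarrow> deg_ge (M i (\<sigma> i)) (d i)"
  shows "deg_ge (hahn_diag_prod M \<sigma> k) (\<Sum>i<k. d i) \<and>
    hahn_diag_prod M \<sigma> k (\<Sum>i<k. d i) = (\<Prod>i<k. M i (\<sigma> i) (d i))"
  using assms
proof (induction k)
  case 0
  then show ?case by (simp add: deg_ge_def hahn_one_def)
next
  case (Suc k)
  then have "deg_ge (hahn_diag_prod M \<sigma> k) (\<Sum>i<k. d i)" "deg_ge (M k (\<sigma> k)) (d k)"
      "hahn_diag_prod M \<sigma> k (\<Sum>i<k. d i) = (\<Prod>i<k. M i (\<sigma> i) (d i))"
    by auto
  then show ?case using deg_ge_hahn_mult by simp
qed

section \<open>Novikov series\<close>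

text \<open>Having only finitely many exponents below every bound, rather than well-ordered support, makes
  convolution sums finite and lets inverses and square roots be built by countable iteration.\<close>

typedef novikov = "{f :: real \<Rightarrow> complex. \<forall>c. finite {a. a \<le> c \<and> f a \<noteq> 0}}"
  morphisms cf Abs_novikov
  by (rule exI[of _ "\<lambda>_. 0"]) simp

lemma finite_supp_le: "finite {a. a \<le> c \<and> cf f a \<noteq> 0}"
  using cf[of f] by simp

lemma cf_Abs:
  assumes "\<And>c. finite {a. a \<le> c \<and> f a \<noteq> 0}"
  shows "cf (Abs_novikov f) = f"
  using assms by (simp add: Abs_novikov_inverse)

lemma novikov_eqI: "(\<And>x. cf f x = cf g x) \<Longrightarrow> f = g"
  by (metis cf_inject ext)

text \<open>Only finitely many exponents lie below a chosen one, so a least one exists. This makes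
  Novikov series admissible as entries of a lift.\<close>

lemma is_hahn_cf: "is_hahn (cf f)"
  unfolding is_hahn_def
proof (intro allI impI)
  fix S assume S: "S \<subseteq> hahn_supp (cf f)" "S \<noteq> {}"
  then obtain s where s: "s \<in> S" by blast
  let ?T = "{a \<in> S. a \<le> s}"
  have "?T \<subseteq> {a. a \<le> s \<and> cf f a \<noteq> 0}"
    using S(1) by (auto simp: hahn_supp_def)
  then have fin: "finite ?T" using finite_supp_le finite_subset by blast
  have ne: "?T \<noteq> {}" using s by blast
  have "Min ?T \<le> x" if "x \<in> S" for x
  proof (cases "x \<le> s")
    case True
    with that fin show ?thesis by (intro Min_le) auto
  next
    case False
    then show ?thesis using Min_in[OF fin ne] by auto
  qed
  moreover have "Min ?T \<in> S" using Min_in[OF fin ne] by blast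
  ultimately show "\<exists>m\<in>S. \<forall>x\<in>S. m \<le> x" by blast
qed

lemma ex_lower_bound: "\<exists>l. \<forall>x<l. cf f x = 0"
proof (cases "cf f = hahn_zero")
  case True
  then show ?thesis by (simp add: hahn_zero_def)
next
  case False
  then show ?thesis using hahn_deg_leading(1)[OF is_hahn_cf] unfolding deg_ge_def by blast
qed

text \<open>If two exponents are at least \<open>l\<close> and add up to \<open>c\<close>, each is
  at most \<open>c - l\<close>; any cutoff \<open>d\<close> beyond that gives a sufficient finite
  box.\<close>

lemma hahn_mult_cf_eq_sum:
  assumes "\<forall>x<l. cf f x = 0" "\<forall>x<l. cf g x = 0" "c - l \<le> d"
  shows "hahn_mult (cf f) (cf g) c =
    (\<Sum>a\<in>{a. a \<le> d \<and> cf f a \<noteq> 0}. \<Sum>b\<in>{a. a \<le> d \<and> cf g a \<noteq> 0}.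
       if a + b = c then cf f a * cf g b else 0)"
proof (rule hahn_mult_eq_sum[OF finite_supp_le finite_supp_le])
  fix a b assume *: "cf f a \<noteq> 0" "cf g b \<noteq> 0" "a + b = c"
  then have "l \<le> a" "l \<le> b" using assms(1,2) by (force simp: not_less[symmetric])+
  with * assms(3) show "a \<in> {a. a \<le> d \<and> cf f a \<noteq> 0} \<and> b \<in> {a. a \<le> d \<and> cf g a \<noteq> 0}"
    by auto
qed

lemma ex_lower_bound3:
  "\<exists>l\<le>0. (\<forall>x<l. cf f x = 0) \<and> (\<forall>x<l. cf g x = 0) \<and> (\<forall>x<l. cf h x = 0)"
proof -
  obtain j where "\<forall>x<j. cf f x = 0" using ex_lower_bound ..
  moreover obtain k where "\<forall>x<k. cf g x = 0" using ex_lower_bound ..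
  moreover obtain l where "\<forall>x<l. cf h x = 0" using ex_lower_bound ..
  ultimately show ?thesis by (intro exI[of _ "min 0 (min j (min k l))"]) auto
qed

lemma ex_if_double_sum_nonzero:
  fixes h :: "'a \<Rightarrow> 'b \<Rightarrow> 'c :: comm_monoid_add"
  assumes "(\<Sum>a\<in>F. \<Sum>b\<in>G. if P a b then h a b else 0) \<noteq> 0"
  shows "\<exists>a\<in>F. \<exists>b\<in>G. P a b"
proof (rule ccontr)
  assume "\<not> ?thesis"
  then have "(\<Sum>a\<in>F. \<Sum>b\<in>G. if P a b then h a b else 0) = 0"
    by (intro sum.neutral ballI) simp
  with assms show False by simp
qed

lemma finite_hahn_mult_supp_le: "finite {x. x \<le> c \<and> hahn_mult (cf f) (cf g) x \<noteq> 0}"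
proof -
  obtain l where l: "\<forall>x<l. cf f x = 0" "\<forall>x<l. cf g x = 0"
    using ex_lower_bound3[of f g g] by blast
  let ?F = "{a. a \<le> c - l \<and> cf f a \<noteq> 0}" and ?G = "{a. a \<le> c - l \<and> cf g a \<noteq> 0}"
  have "{x. x \<le> c \<and> hahn_mult (cf f) (cf g) x \<noteq> 0} \<subseteq> (\<lambda>(a,b). a + b) ` (?F \<times> ?G)"
  proof
    fix x assume x: "x \<in> {x. x \<le> c \<and> hahn_mult (cf f) (cf g) x \<noteq> 0}"
    then have "(\<Sum>a\<in>?F. \<Sum>b\<in>?G. if a + b = x then cf f a * cf g b else 0) \<noteq> 0"
      using hahn_mult_cf_eq_sum[OF l, of x "c - l"] by simp
    then obtain a b where "a \<in> ?F" "b \<in> ?G" "a + b = x"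
      using ex_if_double_sum_nonzero by fast
    then show "x \<in> (\<lambda>(a,b). a + b) ` (?F \<times> ?G)" by force
  qed
  then show ?thesis
    by (rule finite_subset) (intro finite_imageI finite_cartesian_product finite_supp_le)
qed

section \<open>The commutative ring of Novikov series\<close>

instantiation novikov :: comm_ring_1
begin

definition "0 = Abs_novikov hahn_zero"
definition "1 = Abs_novikov hahn_one"
definition "f + g = Abs_novikov (\<lambda>x. cf f x + cf g x)"
definition "- f = Abs_novikov (\<lambda>x. - cf f x)"
definition "f - g = f + - (g :: novikov)"
definition "f * g = Abs_novikov (hahn_mult (cf f) (cf g))"

lemma cf_zero: "cf 0 x = 0"
  by (simp add: zero_novikov_def cf_Abs hahn_zero_def)

lemma cf_one_fun: "cf 1 = hahn_one"
  unfolding one_novikov_def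
proof (rule cf_Abs)
  show "finite {a. a \<le> c \<and> hahn_one a \<noteq> 0}" for c
    by (rule finite_subset[of _ "{0}"]) (auto simp: hahn_one_def)
qed

lemma cf_add: "cf (f + g) x = cf f x + cf g x"
proof -
  have "finite {a. a \<le> c \<and> cf f a + cf g a \<noteq> 0}" for c
    by (rule finite_subset[OF _ finite_UnI[OF finite_supp_le[of c f] finite_supp_le[of c g]]]) auto
  then show ?thesis by (simp add: plus_novikov_def cf_Abs)
qed

lemma cf_uminus: "cf (- f) x = - cf f x"
  by (simp add: uminus_novikov_def cf_Abs finite_supp_le)

lemma cf_mult_fun: "cf (f * g) = hahn_mult (cf f) (cf g)"
  by (simp add: times_novikov_def cf_Abs finite_hahn_mult_supp_le)

lemma cf_mult:
  assumes "\<forall>x<l. cf f x = 0" "\<forall>x<l. cf g x = 0" "c - l \<le> d"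
  shows "cf (f * g) c =
    (\<Sum>a\<in>{a. a \<le> d \<and> cf f a \<noteq> 0}. \<Sum>b\<in>{a. a \<le> d \<and> cf g a \<noteq> 0}.
       if a + b = c then cf f a * cf g b else 0)"
  using hahn_mult_cf_eq_sum[OF assms] by (simp add: cf_mult_fun)

lemma novikov_mult_commute: "f * g = g * (f :: novikov)"
proof (rule novikov_eqI)
  fix x
  obtain l where l: "\<forall>x<l. cf f x = 0" "\<forall>x<l. cf g x = 0"
    using ex_lower_bound3[of f g g] by blast
  show "cf (f * g) x = cf (g * f) x"
    unfolding cf_mult[OF l order_refl] cf_mult[OF l(2,1) order_refl]
    by (subst sum.swap) (intro sum.cong refl, auto simp: add.commute)
qed

text \<open>Three exponents that are at least \<open>l\<close> and sum to \<open>c\<close> are each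
  at most \<open>c - 2 * l\<close>, so a triple product is a triple sum over one finite box.
  Commutativity turns \<open>f * (g * h)\<close> into \<open>(g * h) * f\<close>, so one expansion
  serves both bracketings.\<close>

lemma novikov_mult_assoc: "(f * g) * h = f * (g * (h :: novikov))"
proof (rule novikov_eqI)
  have reassoc: "cf ((f * g) * h) c =
    (\<Sum>a\<in>{a. a \<le> d \<and> cf f a \<noteq> 0}. \<Sum>b\<in>{a. a \<le> d \<and> cf g a \<noteq> 0}. \<Sum>e\<in>{a. a \<le> d \<and> cf h a \<noteq> 0}.
       if a + b + e = c then cf f a * cf g b * cf h e else 0)"
    if l: "l \<le> 0" "\<forall>x<l. cf f x = 0" "\<forall>x<l. cf g x = 0" "\<forall>x<l. cf h x = 0" "c - 2 * l \<le> d"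
    for f g h :: novikov and l c d
  proof -
    let ?F = "{a. a \<le> d \<and> cf f a \<noteq> 0}" and ?G = "{a. a \<le> d \<and> cf g a \<noteq> 0}"
      and ?H = "{a. a \<le> d \<and> cf h a \<noteq> 0}"
    \<comment> \<open>A finite set holding all exponents of \<open>f * g\<close> that matter.
      Summing over it lets the inner convolution be expanded; afterwards only
      \<open>x = a + b\<close> survives for given \<open>a\<close> and \<open>b\<close>.\<close>
    let ?X = "(\<lambda>(a,b). a + b) ` (?F \<times> ?G)"
    have fin: "finite ?X" "finite ?H" "finite ?F" "finite ?G"
      by (intro finite_imageI finite_cartesian_product finite_supp_le)+
    have fg: "cf (f * g) x = (\<Sum>a\<in>?F. \<Sum>b\<in>?G. if a + b = x then cf f a * cf g b else 0)"
      if "x \<le> c - l" for x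
      using that l(5) by (intro cf_mult[OF l(2,3)]) auto
    have "cf ((f * g) * h) c = (\<Sum>x\<in>?X. \<Sum>e\<in>?H. if x + e = c then cf (f * g) x * cf h e else 0)"
      unfolding cf_mult_fun[of "f * g" h]
    proof (rule hahn_mult_eq_sum[OF fin(1,2)])
      fix x e assume *: "cf (f * g) x \<noteq> 0" "cf h e \<noteq> 0" "x + e = c"
      have "l \<le> e" using *(2) l(4) by (force simp: not_less[symmetric])
      then have x: "x \<le> c - l" using *(3) by simp
      then obtain a b where ab: "a \<in> ?F" "b \<in> ?G" "a + b = x"
        using ex_if_double_sum_nonzero[OF *(1)[unfolded fg[OF x]]] by fast
      then have "l \<le> a" "l \<le> b" using l(2,3) by (force simp: not_less[symmetric])+
      with ab * l(1,5) have "e \<le> d" by auto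
      with ab * show "x \<in> ?X \<and> e \<in> ?H" by force
    qed
    also have "\<dots> = (\<Sum>x\<in>?X. \<Sum>e\<in>?H. \<Sum>a\<in>?F. \<Sum>b\<in>?G.
        if a + b = x then if x + e = c then cf f a * cf g b * cf h e else 0 else 0)"
    proof (intro sum.cong refl)
      fix x e assume "e \<in> ?H"
      then have "l \<le> e" using l(4) by (force simp: not_less[symmetric])
      then have "cf (f * g) x = (\<Sum>a\<in>?F. \<Sum>b\<in>?G. if a + b = x then cf f a * cf g b else 0)"
        if "x + e = c"
        using that by (intro fg) auto
      then show "(if x + e = c then cf (f * g) x * cf h e else 0) =
        (\<Sum>a\<in>?F. \<Sum>b\<in>?G. if a + b = x then if x + e = c then cf f a * cf g b * cf h e else 0 else 0)"
        by (cases "x + e = c") (simp_all add: sum_distrib_right if_distrib[of "\<lambda>y. y * cf h e"] cong: if_cong)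
    qed
    also have "\<dots> = (\<Sum>a\<in>?F. \<Sum>b\<in>?G. \<Sum>e\<in>?H. \<Sum>x\<in>?X.
        if a + b = x then if x + e = c then cf f a * cf g b * cf h e else 0 else 0)"
      by (subst sum.swap[of _ ?H ?X], subst sum.swap[of _ ?F ?X], subst sum.swap[of _ ?F ?H],
          subst sum.swap[of _ ?G ?X], subst sum.swap[of _ ?G ?H]) (rule refl)
    also have "\<dots> = (\<Sum>a\<in>?F. \<Sum>b\<in>?G. \<Sum>e\<in>?H.
       if a + b + e = c then cf f a * cf g b * cf h e else 0)"
    proof (intro sum.cong refl)
      fix a b e assume "a \<in> ?F" "b \<in> ?G"
      then have "a + b \<in> ?X" by force
      then show "(\<Sum>x\<in>?X. if a + b = x then if x + e = c then cf f a * cf g b * cf h e else 0 else 0)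
        = (if a + b + e = c then cf f a * cf g b * cf h e else 0)"
        using fin(1) by (simp add: sum.delta)
    qed
    finally show ?thesis .
  qed
  fix c
  obtain l where l: "l \<le> 0" "\<forall>x<l. cf f x = 0" "\<forall>x<l. cf g x = 0" "\<forall>x<l. cf h x = 0"
    using ex_lower_bound3 by blast
  let ?F = "{a. a \<le> c - 2 * l \<and> cf f a \<noteq> 0}" and ?G = "{a. a \<le> c - 2 * l \<and> cf g a \<noteq> 0}"
    and ?H = "{a. a \<le> c - 2 * l \<and> cf h a \<noteq> 0}"
  have "cf (f * (g * h)) c = cf ((g * h) * f) c"
    by (simp add: novikov_mult_commute)
  also have "\<dots> = (\<Sum>b\<in>?G. \<Sum>e\<in>?H. \<Sum>a\<in>?F. if b + e + a = c then cf g b * cf h e * cf f a else 0)"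
    by (rule reassoc[OF l(1,3,4,2) order_refl])
  also have "\<dots> = (\<Sum>b\<in>?G. \<Sum>a\<in>?F. \<Sum>e\<in>?H. if b + e + a = c then cf g b * cf h e * cf f a else 0)"
    by (intro sum.cong refl sum.swap)
  also have "\<dots> = (\<Sum>a\<in>?F. \<Sum>b\<in>?G. \<Sum>e\<in>?H. if b + e + a = c then cf g b * cf h e * cf f a else 0)"
    by (rule sum.swap)
  also have "\<dots> = (\<Sum>a\<in>?F. \<Sum>b\<in>?G. \<Sum>e\<in>?H. if a + b + e = c then cf f a * cf g b * cf h e else 0)"
    by (intro sum.cong refl) (simp add: ac_simps)
  also have "\<dots> = cf (f * g * h) c"
    by (rule reassoc[OF l order_refl, symmetric])
  finally show "cf (f * g * h) c = cf (f * (g * h)) c" ..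
qed

instance
proof
  fix f g h :: novikov
  show "f * g * h = f * (g * h)" by (rule novikov_mult_assoc)
  show "f * g = g * f" by (rule novikov_mult_commute)
  show "1 * f = f"
  proof (rule novikov_eqI)
    fix x
    have "cf (1 * f) x = (\<Sum>a\<in>{0}. \<Sum>b\<in>{x}. if a + b = x then hahn_one a * cf f b else 0)"
      unfolding cf_mult_fun cf_one_fun by (rule hahn_mult_eq_sum) (auto simp: hahn_one_def split: if_splits)
    then show "cf (1 * f) x = cf f x" by (simp add: hahn_one_def)
  qed
  show "(f + g) * h = f * h + g * h"
  proof (rule novikov_eqI)
    fix c
    obtain l where l: "\<forall>x<l. cf f x = 0" "\<forall>x<l. cf g x = 0" "\<forall>x<l. cf h x = 0"
      using ex_lower_bound3 by blast
    let ?F = "{a. a \<le> c - l \<and> cf f a \<noteq> 0} \<union> {a. a \<le> c - l \<and> cf g a \<noteq> 0}"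
      and ?H = "{a. a \<le> c - l \<and> cf h a \<noteq> 0}"
    have fin: "finite ?F" "finite ?H" by (intro finite_UnI finite_supp_le)+
    \<comment> \<open>Used for \<open>k\<close> equal to the coefficients of \<open>f + g\<close>,
      \<open>f\<close> and \<open>g\<close>, so that all three convolutions run over the same box
      and can be compared termwise.\<close>
    have *: "hahn_mult k (cf h) c = (\<Sum>a\<in>?F. \<Sum>b\<in>?H. if a + b = c then k a * cf h b else 0)"
      if k: "\<And>a. k a \<noteq> 0 \<Longrightarrow> cf f a \<noteq> 0 \<or> cf g a \<noteq> 0" for k
    proof (rule hahn_mult_eq_sum[OF fin])
      fix a b assume ab: "k a \<noteq> 0" "cf h b \<noteq> 0" "a + b = c"
      then have "l \<le> a" "l \<le> b" using l k[OF ab(1)] by (force simp: not_less[symmetric])+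
      with ab k[OF ab(1)] show "a \<in> ?F \<and> b \<in> ?H" by auto
    qed
    show "cf ((f + g) * h) c = cf (f * h + g * h) c"
      unfolding cf_add cf_mult_fun
      by (subst *, (force simp: cf_add)[], subst *, force, subst *, force)
        (auto simp: cf_add sum.distrib[symmetric] distrib_right intro!: sum.cong)
  qed
  show "(0 :: novikov) \<noteq> 1"
    by (metis cf_one_fun cf_zero hahn_one_def zero_neq_one)
qed (auto intro!: novikov_eqI simp: minus_novikov_def cf_add cf_uminus cf_zero)

end

section \<open>Coefficients, monomials and degree bounds\<close>

lemma cf_diff: "cf (f - g) x = cf f x - cf g x"
  unfolding minus_novikov_def cf_add cf_uminus by simp

lemma cf_one: "cf 1 x = (if x = 0 then 1 else 0)"
  by (simp add: cf_one_fun hahn_one_def)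

lemma cf_sum: "cf (sum f I) x = (\<Sum>i\<in>I. cf (f i) x)"
  by (induction I rule: infinite_finite_induct) (auto simp: cf_zero cf_add)

text \<open>The term \<open>c t^a\<close>; with \<open>a = 0\<close> it embeds the complex
  constants.\<close>

definition single :: "complex \<Rightarrow> real \<Rightarrow> novikov" where
  "single c a = Abs_novikov (\<lambda>x. if x = a then c else 0)"

lemma cf_single: "cf (single c a) x = (if x = a then c else 0)"
proof -
  have "finite {x. x \<le> d \<and> (if x = a then c else 0) \<noteq> 0}" for d
    by (rule finite_subset[of _ "{a}"]) auto
  then show ?thesis by (simp add: single_def cf_Abs)
qed

lemma cf_single_mult: "cf (single c a * f) x = c * cf f (x - a)"
proof -
  have "cf (single c a * f) x =
      (\<Sum>u\<in>{a}. \<Sum>v\<in>{x - a}. if u + v = x then cf (single c a) u * cf f v else 0)"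
    unfolding cf_mult_fun by (rule hahn_mult_eq_sum) (auto simp: cf_single split: if_splits)
  then show ?thesis by (simp add: cf_single)
qed

lemma single_mult: "single c a * single d b = single (c * d) (a + b)"
  by (rule novikov_eqI, unfold cf_single_mult cf_single) (simp add: diff_eq_eq add.commute)

lemma single_one: "single 1 0 = 1"
  by (rule novikov_eqI) (simp add: cf_single cf_one)

lemma single_half: "single (1 / 2) 0 + single (1 / 2) 0 = 1"
proof (rule novikov_eqI)
  show "cf (single (1 / 2) 0 + single (1 / 2) 0) x = cf 1 x" for x
    unfolding cf_add cf_single cf_one by simp
qed

lemma single_prod: "finite I \<Longrightarrow> (\<Prod>i\<in>I. single (c i) (a i)) = single (prod c I) (sum a I)"
  by (induction I rule: finite_induct) (simp_all add: single_one single_mult)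

lemma deg_ge_mult: "deg_ge (cf f) c \<Longrightarrow> deg_ge (cf g) d \<Longrightarrow> deg_ge (cf (f * g)) (c + d)"
  by (simp add: cf_mult_fun deg_ge_hahn_mult(1))

lemma deg_ge_add: "deg_ge (cf f) c \<Longrightarrow> deg_ge (cf g) c \<Longrightarrow> deg_ge (cf (f + g)) c"
  by (simp add: deg_ge_def cf_add)

lemma deg_ge_diff: "deg_ge (cf f) c \<Longrightarrow> deg_ge (cf g) c \<Longrightarrow> deg_ge (cf (f - g)) c"
  by (simp add: deg_ge_def cf_diff)

lemma deg_ge_uminus: "deg_ge (cf f) c \<Longrightarrow> deg_ge (cf (- f)) c"
  by (simp add: deg_ge_def cf_uminus)

lemma deg_ge_zero: "deg_ge (cf 0) c"
  by (simp add: deg_ge_def cf_zero)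

lemma deg_ge_single: "deg_ge (cf (single c a)) a"
  by (simp add: deg_ge_def cf_single)

section \<open>Inverses and square roots by contraction\<close>

text \<open>The Banach fixed point argument for the valuation: each iteration from 0 raises the
  order of agreement by \<open>\<delta>\<close>, so every coefficient is eventually constant and the
  limit is taken coefficientwise.\<close>

lemma ex_fixpoint_of_contraction:
  assumes "\<delta> > 0"
    and closed: "\<And>y. deg_ge (cf y) \<delta> \<Longrightarrow> deg_ge (cf (T y)) \<delta>"
    and contr: "\<And>y z c. deg_ge (cf y) \<delta> \<Longrightarrow> deg_ge (cf z) \<delta> \<Longrightarrow> deg_ge (cf (y - z)) c
                  \<Longrightarrow> deg_ge (cf (T y - T z)) (c + \<delta>)"
  shows "\<exists>y. deg_ge (cf y) \<delta> \<and> T y = y"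
proof -
  define s where "s k = (T ^^ k) 0" for k
  have s: "deg_ge (cf (s k)) \<delta>" for k
    by (induction k) (simp_all add: s_def deg_ge_zero closed)
  have step: "deg_ge (cf (s (Suc k) - s k)) (real (Suc k) * \<delta>)" for k
  proof (induction k)
    case 0
    show ?case using s[of 1] by (simp add: s_def)
  next
    case (Suc k)
    have "deg_ge (cf (T (s (Suc k)) - T (s k))) (real (Suc k) * \<delta> + \<delta>)"
      by (rule contr[OF s s Suc])
    moreover have "T (s (Suc k)) - T (s k) = s (Suc (Suc k)) - s (Suc k)"
      by (simp add: s_def)
    ultimately show ?case by (simp add: algebra_simps)
  qed
  have cauchy: "cf (s m) x = cf (s k) x" if "k \<le> m" "x < real (Suc k) * \<delta>" for k m x
    using that(1)
  proof (induction m rule: dec_induct)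
    case (step m)
    have "real (Suc k) * \<delta> \<le> real (Suc m) * \<delta>"
      using step.hyps assms(1) by (intro mult_right_mono) auto
    then have "cf (s (Suc m) - s m) x = 0"
      using that(2) \<open>\<And>k. deg_ge (cf (s (Suc k) - s k)) _\<close>[of m] by (simp add: deg_ge_def)
    then show ?case using step.IH by (simp add: cf_diff)
  qed simp
  \<comment> \<open>Roughly \<open>x / \<delta>\<close> iterations settle the coefficient at
    \<open>x\<close>; for negative \<open>x\<close>, \<open>nat\<close> gives 0, which suffices
    because \<open>x < \<delta>\<close>.\<close>
  define N where "N x = nat \<lceil>x / \<delta>\<rceil>" for x
  have N: "x < real (Suc (N x)) * \<delta>" for x
  proof -
    have "x / \<delta> \<le> real (N x)" unfolding N_def by linarith
    then have "x \<le> real (N x) * \<delta>" using assms(1) by (simp add: pos_divide_le_eq)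
    then show ?thesis using assms(1) by (simp add: algebra_simps)
  qed
  have mono_N: "N x \<le> N c" if "x \<le> c" for x c
    using that assms(1) unfolding N_def by (intro nat_mono ceiling_mono divide_right_mono) auto
  define y where "y = Abs_novikov (\<lambda>x. cf (s (N x)) x)"
  have cf_y: "cf y = (\<lambda>x. cf (s (N x)) x)"
    unfolding y_def
  proof (rule cf_Abs)
    fix c
    \<comment> \<open>Up to \<open>c\<close> the limit coincides with the single iterate
      \<open>s (N c)\<close>, so it inherits local finiteness.\<close>
    have "cf (s (N c)) x = cf (s (N x)) x" if "x \<le> c" for x
      using cauchy[OF mono_N[OF that] N] .
    then have "{a. a \<le> c \<and> cf (s (N a)) a \<noteq> 0} \<subseteq> {a. a \<le> c \<and> cf (s (N c)) a \<noteq> 0}"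
      by auto
    then show "finite {a. a \<le> c \<and> cf (s (N a)) a \<noteq> 0}"
      using finite_supp_le finite_subset by blast
  qed
  have y: "deg_ge (cf y) \<delta>"
    using s by (simp add: deg_ge_def cf_y)
  have close: "cf y x = cf (s k) x" if "x < real (Suc k) * \<delta>" for k x
  proof (cases "k \<le> N x")
    case True
    then show ?thesis using cauchy that by (simp add: cf_y)
  next
    case False
    then show ?thesis using cauchy[OF _ N, of x k] by (simp add: cf_y)
  qed
  have "T y = y"
  proof (rule novikov_eqI)
    fix x
    let ?k = "N x"
    \<comment> \<open>\<open>y\<close> and the iterate agree below an order exceeding
      \<open>x\<close>, hence so do their images under \<open>T\<close>, and the next iterate has
      the same coefficient at \<open>x\<close>.\<close>
    have "deg_ge (cf (y - s ?k)) (real (Suc ?k) * \<delta>)"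
      using close by (simp add: deg_ge_def cf_diff)
    from contr[OF y s this] have "cf (T y) x = cf (T (s ?k)) x"
      using N[of x] assms(1) by (simp add: deg_ge_def cf_diff)
    also have "\<dots> = cf (s (Suc ?k)) x" by (simp add: s_def)
    also have "\<dots> = cf (s ?k) x" using cauchy[OF _ N, of x "Suc ?k"] by simp
    finally show "cf (T y) x = cf y x" by (simp add: cf_y)
  qed
  with y show ?thesis by blast
qed

text \<open>The equation is rewritten as the fixed point problem \<open>y = - e - e * y\<close>,
  where multiplication by \<open>e\<close> contracts.\<close>

lemma ex_inverse_one_plus:
  assumes "\<delta> > 0" "deg_ge (cf e) \<delta>"
  shows "\<exists>y. deg_ge (cf y) \<delta> \<and> (1 + e) * (1 + y) = 1"
proof -
  have "\<exists>y. deg_ge (cf y) \<delta> \<and> - e - e * y = y"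
  proof (rule ex_fixpoint_of_contraction[OF assms(1)])
    fix y assume y: "deg_ge (cf y) \<delta>"
    have "deg_ge (cf (e * y)) \<delta>"
      using deg_ge_mult[OF assms(2) y] assms(1) deg_ge_mono by fastforce
    then show "deg_ge (cf (- e - e * y)) \<delta>"
      by (intro deg_ge_diff deg_ge_uminus assms(2))
  next
    fix y z c assume "deg_ge (cf (y - z)) c"
    from deg_ge_uminus[OF deg_ge_mult[OF assms(2) this]]
    show "deg_ge (cf (- e - e * y - (- e - e * z))) (c + \<delta>)"
      by (simp add: algebra_simps)
  qed
  then obtain y where y: "deg_ge (cf y) \<delta>" "- e - e * y = y" by blast
  have "(1 + e) * (1 + y) = 1 + e + e * y + y" by (simp add: algebra_simps)
  also have "\<dots> = 1 + e + e * y + (- e - e * y)" by (simp only: y(2))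
  finally have "(1 + e) * (1 + y) = 1" by simp
  with y(1) show ?thesis by blast
qed

text \<open>The equation becomes \<open>y = (e - y * y) / 2\<close>. It contracts because
  \<open>y * y - z * z = (y - z) * (y + z)\<close> and the second factor has degree at least
  \<open>\<delta>\<close>.\<close>

lemma ex_sqrt_one_plus:
  assumes "\<delta> > 0" "deg_ge (cf e) \<delta>"
  shows "\<exists>y. deg_ge (cf y) \<delta> \<and> (1 + y) * (1 + y) = 1 + e"
proof -
  let ?h = "single (1 / 2) 0"
  have h: "deg_ge (cf ?h) 0" by (rule deg_ge_single)
  have half: "deg_ge (cf (?h * f)) c" if "deg_ge (cf f) c" for f c
    using deg_ge_mult[OF h that] by simp
  have "\<exists>y. deg_ge (cf y) \<delta> \<and> ?h * (e - y * y) = y"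
  proof (rule ex_fixpoint_of_contraction[OF assms(1)])
    fix y assume y: "deg_ge (cf y) \<delta>"
    have "deg_ge (cf (y * y)) \<delta>"
      using deg_ge_mult[OF y y] assms(1) deg_ge_mono by fastforce
    then show "deg_ge (cf (?h * (e - y * y))) \<delta>"
      by (intro half deg_ge_diff assms(2))
  next
    fix y z c assume *: "deg_ge (cf y) \<delta>" "deg_ge (cf z) \<delta>" "deg_ge (cf (y - z)) c"
    have "deg_ge (cf (- (?h * ((y - z) * (y + z))))) (c + \<delta>)"
      by (intro deg_ge_uminus half deg_ge_mult deg_ge_add *)
    then show "deg_ge (cf (?h * (e - y * y) - ?h * (e - z * z))) (c + \<delta>)"
      by (simp add: algebra_simps)
  qed
  then obtain y where y: "deg_ge (cf y) \<delta>" "?h * (e - y * y) = y" by blast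
  have "e - y * y = (?h + ?h) * (e - y * y)"
    by (simp only: single_half mult_1)
  also have "\<dots> = y + y"
    unfolding distrib_right y(2) ..
  finally have "e - y * y = y + y" .
  then have "(1 + y) * (1 + y) = 1 + e" by (simp add: algebra_simps)
  with y(1) show ?thesis by blast
qed

text \<open>Dividing by the leading term leaves constant term 1 and otherwise positive exponents.
  These have a least element, which supplies the gap \<open>\<delta>\<close>; if
  \<open>e = 0\<close>, any positive \<open>\<delta>\<close> will do.\<close>

lemma normalize_leading_term:
  assumes "f \<noteq> 0"
  shows "\<exists>d \<delta> e. f = single (cf f d) d * (1 + e) \<and> cf f d \<noteq> 0 \<and> deg_ge (cf f) d \<and> \<delta> > 0 \<and> deg_ge (cf e) \<delta>"
proof -
  define d where "d = hahn_deg (cf f)"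
  have "cf f \<noteq> hahn_zero"
    using assms novikov_eqI[of f 0] by (auto simp: cf_zero hahn_zero_def)
  then have d: "cf f d \<noteq> 0" "deg_ge (cf f) d"
    using hahn_deg_leading[OF is_hahn_cf] by (auto simp: d_def)
  define e where "e = single (1 / cf f d) (- d) * f - 1"
  have cf_e: "cf e x = (if x = 0 then 0 else cf f (x + d) / cf f d)" for x
    using d(1) by (auto simp: e_def cf_diff cf_single_mult cf_one add.commute)
  have "\<exists>\<delta>>0. deg_ge (cf e) \<delta>"
  proof (cases "cf e = hahn_zero")
    case True
    then show ?thesis by (intro exI[of _ 1]) (simp add: deg_ge_def hahn_zero_def)
  next
    case False
    then obtain m where m: "cf e m \<noteq> 0" "deg_ge (cf e) m"
      using hahn_deg_leading[OF is_hahn_cf] by blast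
    have "m > 0"
      using m(1) d(2) by (force simp: cf_e deg_ge_def split: if_splits)
    with m(2) show ?thesis by blast
  qed
  moreover have "single (cf f d) d * (1 + e) = f"
    using d(1) by (simp add: e_def mult.assoc[symmetric] single_mult single_one)
  ultimately show ?thesis using d by metis
qed

text \<open>Such an \<open>f\<close> is a unit of the valuation ring: its leading exponent is 0, so
  inverting the leading constant and the factor \<open>1 + e\<close> introduces no negative
  exponents.\<close>

lemma ex_inverse_of_residue_nonzero:
  assumes "deg_ge (cf f) 0" "cf f 0 \<noteq> 0"
  shows "\<exists>g. deg_ge (cf g) 0 \<and> f * g = 1"
proof -
  have "f \<noteq> 0" using assms(2) by (auto simp: cf_zero)
  then obtain d \<delta> e where *: "f = single (cf f d) d * (1 + e)" "cf f d \<noteq> 0" "deg_ge (cf f) d"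
      "\<delta> > 0" "deg_ge (cf e) \<delta>"
    using normalize_leading_term by blast
  have "d = 0"
    using assms *(2,3) unfolding deg_ge_def by (meson linorder_neqE)
  from ex_inverse_one_plus[OF *(4,5)] obtain y where y: "deg_ge (cf y) \<delta>" "(1 + e) * (1 + y) = 1"
    by blast
  let ?g = "single (1 / cf f d) 0 * (1 + y)"
  have "deg_ge (cf ?g) 0"
    using y(1) *(4) by (auto simp: deg_ge_def cf_single_mult cf_add cf_one)
  moreover have "f * ?g = (single (cf f d) d * single (1 / cf f d) 0) * ((1 + e) * (1 + y))"
    by (subst *(1)) (simp only: mult_ac)
  then have "f * ?g = 1"
    using y(2) \<open>d = 0\<close> *(2) by (simp add: single_mult single_one)
  ultimately show ?thesis by blast
qed

text \<open>The leading term has a root since complex numbers have square roots and real exponents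
  can be halved; the factor \<open>1 + e\<close> is handled by contraction.\<close>

lemma ex_sqrt:
  assumes "deg_ge (cf f) 0"
  shows "\<exists>g. deg_ge (cf g) 0 \<and> g * g = f"
proof (cases "f = 0")
  case True
  then show ?thesis using deg_ge_zero by (intro exI[of _ 0]) simp
next
  case False
  then obtain d \<delta> e where *: "f = single (cf f d) d * (1 + e)" "cf f d \<noteq> 0" "deg_ge (cf f) d"
      "\<delta> > 0" "deg_ge (cf e) \<delta>"
    using normalize_leading_term by blast
  have "d \<ge> 0"
    using assms *(2) by (force simp: deg_ge_def)
  from ex_sqrt_one_plus[OF *(4,5)] obtain y where y: "deg_ge (cf y) \<delta>" "(1 + y) * (1 + y) = 1 + e"
    by blast
  let ?g = "single (csqrt (cf f d)) (d / 2) * (1 + y)"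
  have "deg_ge (cf ?g) 0"
    using y(1) *(4) \<open>d \<ge> 0\<close> by (auto simp: deg_ge_def cf_single_mult cf_add cf_one)
  moreover have "?g * ?g = (single (csqrt (cf f d)) (d / 2) * single (csqrt (cf f d)) (d / 2)) * ((1 + y) * (1 + y))"
    by (simp only: mult_ac)
  then have "?g * ?g = single (cf f d) d * (1 + e)"
    unfolding y(2) single_mult using power2_csqrt[of "cf f d"] by (simp add: power2_eq_square)
  ultimately show ?thesis using *(1) by metis
qed

section \<open>Quadratic equations over the valuation ring\<close>

lemma cf_mult_0: "deg_ge (cf f) 0 \<Longrightarrow> deg_ge (cf g) 0 \<Longrightarrow> cf (f * g) 0 = cf f 0 * cf g 0"
  using deg_ge_hahn_mult(2)[of "cf f" 0 "cf g" 0] by (simp add: cf_mult_fun)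

lemma deg_ge_mult_0: "deg_ge (cf f) 0 \<Longrightarrow> deg_ge (cf g) 0 \<Longrightarrow> deg_ge (cf (f * g)) 0"
  using deg_ge_mult[of f 0 g 0] by simp

text \<open>Divide by \<open>c\<close> and complete the square: with \<open>p = b / (2 c)\<close>
  and \<open>q = a / c\<close> the roots are \<open>s - p\<close> and \<open>- s - p\<close>, where
  \<open>s * s = p * p - q\<close>. If both residues vanished, so would those of \<open>p\<close>
  and \<open>q\<close>, and hence those of \<open>b\<close> and \<open>a\<close>.\<close>

lemma quadratic_root_unit_lead:
  assumes int: "deg_ge (cf a) 0" "deg_ge (cf b) 0" "deg_ge (cf c) 0"
    and "cf c 0 \<noteq> 0" "cf a 0 \<noteq> 0 \<or> cf b 0 \<noteq> 0"
  shows "\<exists>x. deg_ge (cf x) 0 \<and> cf x 0 \<noteq> 0 \<and> a + b * x + c * x * x = 0"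
proof -
  let ?h = "single (1 / 2) 0"
  have half: "?h + ?h = 1" "deg_ge (cf ?h) 0"
    by (rule single_half, rule deg_ge_single)
  obtain d where d: "deg_ge (cf d) 0" "c * d = 1"
    using ex_inverse_of_residue_nonzero assms by blast
  let ?p = "?h * b * d" and ?q = "a * d"
  have pq: "deg_ge (cf ?p) 0" "deg_ge (cf ?q) 0"
    by (intro deg_ge_mult_0 int d half)+
  then have "deg_ge (cf (?p * ?p - ?q)) 0"
    by (intro deg_ge_diff deg_ge_mult_0[OF pq(1) pq(1)] pq(2))
  then obtain s where s: "deg_ge (cf s) 0" "s * s = ?p * ?p - ?q"
    using ex_sqrt by blast
  have root: "a + b * x + c * x * x = 0" if "(x + ?p) * (x + ?p) = s * s" for x
  proof -
    have "a + b * x + c * x * x = c * d * a + (?h + ?h) * b * (c * d) * x + c * x * x"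
      using d(2) half(1) by (simp add: mult.commute)
    also have "\<dots> = c * ((x + ?p) * (x + ?p) - (?p * ?p - ?q))"
      by (simp add: algebra_simps)
    finally show ?thesis using that s(2) by simp
  qed
  have roots: "a + b * (s - ?p) + c * (s - ?p) * (s - ?p) = 0"
      "a + b * (- s - ?p) + c * (- s - ?p) * (- s - ?p) = 0"
    by (rule root, simp)+
  have deg: "deg_ge (cf (s - ?p)) 0" "deg_ge (cf (- s - ?p)) 0"
    by (intro deg_ge_diff deg_ge_uminus s pq)+
  have "cf (s - ?p) 0 \<noteq> 0 \<or> cf (- s - ?p) 0 \<noteq> 0"
  proof (rule ccontr)
    assume "\<not> ?thesis"
    then have z: "cf s 0 = cf ?p 0" "cf s 0 = - cf ?p 0"
      by (auto simp: cf_diff cf_uminus neg_eq_iff_add_eq_0 add.commute)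
    then have "cf ?p 0 = 0" "cf s 0 = 0" by auto
    moreover have "cf (s * s) 0 = cf ?p 0 * cf ?p 0 - cf ?q 0"
      unfolding s(2) cf_diff using pq by (simp add: cf_mult_0)
    ultimately have "cf ?p 0 = 0" "cf ?q 0 = 0"
      using s(1) by (auto simp: cf_mult_0)
    moreover have "cf c 0 * cf d 0 = 1"
      using cf_mult_0[OF int(3) d(1)] d(2) by (simp add: cf_one)
    then have "cf d 0 \<noteq> 0" by auto
    moreover have "cf ?p 0 = 1 / 2 * cf b 0 * cf d 0"
      using int half d by (simp add: cf_mult_0 deg_ge_mult_0 cf_single)
    moreover have "cf ?q 0 = cf a 0 * cf d 0"
      using int d by (simp add: cf_mult_0)
    ultimately show False using assms(5) by auto
  qed
  with roots deg show ?thesis by blast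
qed

text \<open>If \<open>c\<close> has residue 0, then \<open>a\<close> and \<open>b\<close> do not, so
  the reversed polynomial has a unit leading coefficient. Its root \<open>y\<close> of nonzero
  residue is a unit, and \<open>1 / y\<close> solves the original equation.\<close>

lemma quadratic_root_residue_nonzero:
  assumes int: "deg_ge (cf a) 0" "deg_ge (cf b) 0" "deg_ge (cf c) 0"
    and "cf a 0 \<noteq> 0 \<and> cf b 0 \<noteq> 0 \<or> cf a 0 \<noteq> 0 \<and> cf c 0 \<noteq> 0 \<or> cf b 0 \<noteq> 0 \<and> cf c 0 \<noteq> 0"
  shows "\<exists>x. deg_ge (cf x) 0 \<and> cf x 0 \<noteq> 0 \<and> a + b * x + c * x * x = 0"
proof (cases "cf c 0 = 0")
  case False
  with assms show ?thesis using quadratic_root_unit_lead by blast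
next
  case True
  with assms obtain y where y: "deg_ge (cf y) 0" "cf y 0 \<noteq> 0" "c + b * y + a * y * y = 0"
    using quadratic_root_unit_lead[of c b a] by blast
  then obtain x where x: "deg_ge (cf x) 0" "y * x = 1"
    using ex_inverse_of_residue_nonzero by blast
  have "cf y 0 * cf x 0 = 1"
    using cf_mult_0[OF y(1) x(1)] x(2) by (simp add: cf_one)
  then have nz: "cf x 0 \<noteq> 0" by auto
  have "a + b * x + c * x * x = a * (y * x) * (y * x) + b * (y * x) * x + c * x * x"
    using x(2) by simp
  also have "\<dots> = (c + b * y + a * y * y) * x * x" by (simp add: algebra_simps)
  finally have "a + b * x + c * x * x = 0" using y(3) by simp
  with nz show ?thesis using x(1) by blast
qed

text \<open>At \<open>deg x = \<alpha>\<close> every term has degree at least \<open>m\<close>, and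
  two terms attain it. Substituting \<open>x = t^\<alpha> y\<close> and dividing by
  \<open>t^m\<close> reduces this to a root \<open>y\<close> with nonzero residue.\<close>

lemma quadratic_root_of_degree:
  fixes a :: "nat \<Rightarrow> novikov"
  assumes deg: "\<And>k. deg_ge (cf (a k)) (m - real k * \<alpha>)"
    and two: "i < 3" "j < 3" "i \<noteq> j" "cf (a i) (m - real i * \<alpha>) \<noteq> 0" "cf (a j) (m - real j * \<alpha>) \<noteq> 0"
  shows "\<exists>x. deg_ge (cf x) \<alpha> \<and> cf x \<alpha> \<noteq> 0 \<and> (\<Sum>k<3. a k * x ^ k) = 0"
proof -
  define b where "b k = single 1 (real k * \<alpha> - m) * a k" for k
  have b: "deg_ge (cf (b k)) 0" for k
    using deg[of k] by (auto simp: b_def deg_ge_def cf_single_mult)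
  have "cf (b k) 0 = cf (a k) (m - real k * \<alpha>)" for k
    by (simp add: b_def cf_single_mult)
  then have "cf (b i) 0 \<noteq> 0" "cf (b j) 0 \<noteq> 0" using two(4,5) by simp_all
  moreover have "i \<in> {0,1,2}" "j \<in> {0,1,2}" using two(1,2) by auto
  ultimately have "cf (b 0) 0 \<noteq> 0 \<and> cf (b 1) 0 \<noteq> 0 \<or> cf (b 0) 0 \<noteq> 0 \<and> cf (b 2) 0 \<noteq> 0
      \<or> cf (b 1) 0 \<noteq> 0 \<and> cf (b 2) 0 \<noteq> 0"
    using two(3) by auto
  from quadratic_root_residue_nonzero[OF b b b this] obtain y
    where y: "deg_ge (cf y) 0" "cf y 0 \<noteq> 0" "b 0 + b 1 * y + b 2 * y * y = 0"
    by blast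
  let ?t = "single 1 \<alpha>" and ?u = "single 1 m"
  have "single 1 (real k * \<alpha>) = ?t ^ k" for k
    by (induction k) (simp_all add: single_one distrib_right single_mult[of 1 _ 1, simplified, symmetric])
  then have "?u * single 1 (real k * \<alpha> - m) = ?t ^ k" for k
    by (simp add: single_mult)
  then have b_t: "?u * b k = a k * ?t ^ k" for k
    unfolding b_def mult.assoc[symmetric] by (simp add: mult.commute[of "a k"])
  have "(\<Sum>k<3. a k * (?t * y) ^ k) = (\<Sum>k<3. ?u * b k * y ^ k)"
    by (simp add: b_t power_mult_distrib mult.assoc)
  also have "\<dots> = ?u * (b 0 + b 1 * y + b 2 * y * y)"
    by (simp add: numeral_3_eq_3 numeral_2_eq_2 algebra_simps)
  finally have "(\<Sum>k<3. a k * (?t * y) ^ k) = 0" using y(3) by simp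
  moreover have "deg_ge (cf (?t * y)) \<alpha>" "cf (?t * y) \<alpha> \<noteq> 0"
    using y(1,2) by (auto simp: deg_ge_def cf_single_mult)
  ultimately show ?thesis by blast
qed

section \<open>Singular lifts\<close>

lemma hahn_diag_prod_cf: "hahn_diag_prod (\<lambda>i j. cf (M i j)) \<sigma> k = cf (\<Prod>i<k. M i (\<sigma> i))"
  by (induction k) (simp_all add: cf_one_fun cf_mult_fun)

text \<open>Moves the determinant into the ring \<open>novikov\<close>, where it can be regrouped as
  a polynomial in one entry.\<close>

lemma hahn_det_cf:
  "hahn_det n (\<lambda>i j. cf (M i j)) =
    cf (\<Sum>\<sigma> | \<sigma> permutes {..<n}. single (of_int (sign \<sigma>)) 0 * (\<Prod>i<n. M i (\<sigma> i)))"
  by (rule ext) (simp add: hahn_det_def hahn_diag_prod_cf cf_sum cf_single_mult)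

text \<open>Equal signs add up to plus or minus the number of elements, which is nonzero in
  characteristic 0.\<close>

lemma sum_sign_nonzero:
  assumes "finite C" "\<rho> \<in> C" "\<And>\<sigma>. \<sigma> \<in> C \<Longrightarrow> sign \<sigma> = sign \<rho>"
  shows "(\<Sum>\<sigma>\<in>C. of_int (sign \<sigma>) :: complex) \<noteq> 0"
proof -
  have "(\<Sum>\<sigma>\<in>C. of_int (sign \<sigma>) :: complex) = of_nat (card C) * of_int (sign \<rho>)"
    using assms(3) by simp
  moreover have "card C \<noteq> 0" using assms(1,2) by auto
  moreover have "sign \<rho> \<noteq> 0" by (cases \<rho> rule: sign_cases) auto
  ultimately show ?thesis by simp
qed

text \<open>At the minimal value \<open>m\<close> only minimising permutations contribute to the
  determinant. If they all share one monomial, they share both the product of leading coefficients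
  and the sign, so the coefficient at \<open>m\<close> survives.\<close>

lemma sym_trop_singular_if_singular_lift:
  assumes A: "sym_real_matrix n A"
    and lift: "symmetric_lift n A L" and det: "hahn_det n L = hahn_zero"
  shows "sym_trop_singular n A"
proof (rule ccontr)
  assume nonsing: "\<not> sym_trop_singular n A"
  let ?P = "{\<sigma>. \<sigma> permutes {..<n}}"
  have finP: "finite ?P" by (simp add: finite_permutations)
  have "?P \<noteq> {}" using permutes_id by blast
  then obtain \<rho> where \<rho>: "\<rho> permutes {..<n}" and "perm_value n A \<rho> = Min (perm_value n A ` ?P)"
    using finP Min_in[of "perm_value n A ` ?P"] by fastforce
  then have min: "perm_value n A \<rho> \<le> perm_value n A \<sigma>" if "\<sigma> permutes {..<n}" for \<sigma>
    using that finP by simp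
  define m where "m = perm_value n A \<rho>"
  define C where "C = {\<sigma> \<in> ?P. perm_value n A \<sigma> = m}"
  \<comment> \<open>The leading coefficient of an entry as a function of its edge, so that products
    along permutations factor through the monomial.\<close>
  define h where "h e = L (fst e) (snd e) (A (fst e) (snd e))" for e
  have h_edge: "L i j (A i j) = h (edge i j)" if "i < n" "j < n" for i j
    using that A lift by (auto simp: h_def edge_def min_def max_def sym_real_matrix_def symmetric_lift_def)
  have lead: "deg_ge (L i j) (A i j)" "L i j (A i j) \<noteq> 0" if "i < n" "j < n" for i j
    using that lift hahn_deg_leading[of "L i j"] by (auto simp: symmetric_lift_def)
  have range: "\<sigma> i < n" if "\<sigma> permutes {..<n}" "i < n" for \<sigma> i
    using permutes_in_image[OF that(1), of i] that(2) by simp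
  have diag: "deg_ge (hahn_diag_prod L \<sigma> n) (perm_value n A \<sigma>)"
    "hahn_diag_prod L \<sigma> n (perm_value n A \<sigma>) = (\<Prod>i<n. L i (\<sigma> i) (A i (\<sigma> i)))"
    if "\<sigma> permutes {..<n}" for \<sigma>
    using hahn_diag_prod_leading[of n L \<sigma> "\<lambda>i. A i (\<sigma> i)"] lead range[OF that]
    by (auto simp: perm_value_def)
  have prod_h: "(\<Prod>i<n. L i (\<sigma> i) (A i (\<sigma> i))) = (\<Prod>i<n. h (edge i (\<sigma> i)))"
    if "\<sigma> permutes {..<n}" for \<sigma>
    using range[OF that] h_edge by (intro prod.cong) auto
  have edges_C: "edges {..<n} \<sigma> = edges {..<n} \<rho>" if "\<sigma> \<in> C" for \<sigma>
  proof (rule ccontr)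
    assume "edges {..<n} \<sigma> \<noteq> edges {..<n} \<rho>"
    then have "sym_trop_singular n A"
      using that min \<rho> unfolding sym_trop_singular_def sym_monomial_eq_edges C_def m_def
      by (intro exI[of _ \<sigma>] exI[of _ \<rho>]) auto
    with nonsing show False ..
  qed
  have C_perm: "\<sigma> permutes {..<n}" if "\<sigma> \<in> C" for \<sigma>
    using that by (simp add: C_def)
  have "hahn_det n L m = (\<Sum>\<sigma>\<in>C. of_int (sign \<sigma>) * hahn_diag_prod L \<sigma> n m)"
    unfolding hahn_det_def
  proof (rule sum.mono_neutral_right[OF finP])
    show "\<forall>\<sigma>\<in>?P - C. of_int (sign \<sigma>) * hahn_diag_prod L \<sigma> n m = 0"
    proof
      fix \<sigma> assume "\<sigma> \<in> ?P - C"
      then have "\<sigma> permutes {..<n}" "m < perm_value n A \<sigma>"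
        using min[of \<sigma>] by (auto simp: C_def m_def)
      then show "of_int (sign \<sigma>) * hahn_diag_prod L \<sigma> n m = 0"
        using diag(1) by (simp add: deg_ge_def)
    qed
  qed (auto simp: C_def)
  also have "\<dots> = (\<Sum>\<sigma>\<in>C. of_int (sign \<sigma>) * prod_mset (image_mset h (edges {..<n} \<rho>)))"
  proof (rule sum.cong[OF refl])
    fix \<sigma> assume \<sigma>: "\<sigma> \<in> C"
    then have "hahn_diag_prod L \<sigma> n m = (\<Prod>i<n. h (edge i (\<sigma> i)))"
      using diag(2)[OF C_perm] prod_h[OF C_perm] by (auto simp: C_def)
    also have "\<dots> = prod_mset (image_mset h (edges {..<n} \<rho>))"
      unfolding prod_eq_prod_edges edges_C[OF \<sigma>] ..
    finally show "of_int (sign \<sigma>) * hahn_diag_prod L \<sigma> n m =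
      of_int (sign \<sigma>) * prod_mset (image_mset h (edges {..<n} \<rho>))" by simp
  qed
  also have "\<dots> = (\<Sum>\<sigma>\<in>C. of_int (sign \<sigma>)) * prod_mset (image_mset h (edges {..<n} \<rho>))"
    by (simp add: sum_distrib_right)
  also have "\<dots> \<noteq> 0"
  proof -
    have "(\<Sum>\<sigma>\<in>C. of_int (sign \<sigma>) :: complex) \<noteq> 0"
    proof (rule sum_sign_nonzero)
      show "finite C" using finP by (simp add: C_def)
      show "\<rho> \<in> C" using \<rho> by (simp add: C_def m_def)
      show "sign \<sigma> = sign \<rho>" if "\<sigma> \<in> C" for \<sigma>
        using sign_eq_if_edges_eq[OF _ C_perm[OF that] \<rho> edges_C[OF that]] by simp
    qed
    moreover have "(\<Prod>i<n. L i (\<rho> i) (A i (\<rho> i))) \<noteq> 0"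
      using lead(2) range[OF \<rho>] by simp
    then have "prod_mset (image_mset h (edges {..<n} \<rho>)) \<noteq> 0"
      unfolding prod_h[OF \<rho>] prod_eq_prod_edges .
    ultimately show ?thesis by simp
  qed
  finally show False using det by (simp add: hahn_zero_def)
qed

text \<open>The entries off the edge \<open>e\<close> become \<open>z^N t^A\<close> with weights
  \<open>N\<close> and one generic complex number \<open>z\<close>; the entry at \<open>e\<close>
  stays an unknown \<open>x\<close>, found as a root of the determinant.\<close>

lemma singular_lift_if_sym_trop_singular:
  assumes A: "sym_real_matrix n A" and sing: "sym_trop_singular n A"
  shows "\<exists>L. symmetric_lift n A L \<and> hahn_det n L = hahn_zero"
proof -
  let ?P = "{\<sigma>. \<sigma> permutes {..<n}}"
  have finP: "finite ?P" by (simp add: finite_permutations)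
  obtain \<sigma> \<tau> where \<sigma>\<tau>: "\<sigma> \<in> ?P" "\<tau> \<in> ?P" "edges {..<n} \<sigma> \<noteq> edges {..<n} \<tau>"
    and min\<sigma>: "\<And>\<rho>. \<rho> \<in> ?P \<Longrightarrow> perm_value n A \<sigma> \<le> perm_value n A \<rho>"
    and min\<tau>: "\<And>\<rho>. \<rho> \<in> ?P \<Longrightarrow> perm_value n A \<tau> \<le> perm_value n A \<rho>"
    using sing by (auto simp: sym_trop_singular_def sym_monomial_eq_edges)
  define m where "m = perm_value n A \<sigma>"
  have m: "perm_value n A \<tau> = m" "\<And>\<rho>. \<rho> \<in> ?P \<Longrightarrow> m \<le> perm_value n A \<rho>"
    using min\<sigma> min\<tau> \<sigma>\<tau>(1,2) by (auto simp: m_def intro: antisym)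
  obtain e where e: "count (edges {..<n} \<sigma>) e \<noteq> count (edges {..<n} \<tau>) e"
    using \<sigma>\<tau>(3) by (auto simp: multiset_eq_iff)
  define \<alpha> where "\<alpha> = A (fst e) (snd e)"
  have A_e: "A i j = \<alpha>" if "i < n" "j < n" "edge i j = e" for i j
    using that A by (auto simp: \<alpha>_def edge_def min_def max_def sym_real_matrix_def split: if_splits)
  have range: "\<rho> i < n" if "\<rho> \<in> ?P" "i < n" for \<rho> i
    using permutes_in_image[of \<rho> "{..<n}" i] that by simp
  \<comment> \<open>The rows in which \<open>\<rho>\<close> picks the variable \<open>e\<close>.
    Such a row is \<open>fst e\<close> or \<open>snd e\<close>, so the determinant has degree at
    most 2 in \<open>x\<close>.\<close>
  define E where "E \<rho> = {..<n} \<inter> {i. edge i (\<rho> i) = e}" for \<rho>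
  define R where "R \<rho> = {..<n} \<inter> - {i. edge i (\<rho> i) = e}" for \<rho>
  have fin: "finite (E \<rho>)" "finite (R \<rho>)" for \<rho> by (auto simp: E_def R_def)
  have ER: "E \<rho> \<union> R \<rho> = {..<n}" "E \<rho> \<inter> R \<rho> = {}" for \<rho> by (auto simp: E_def R_def)
  have count_e: "count (edges {..<n} \<rho>) e = card (E \<rho>)" for \<rho>
    by (auto simp: edges_def count_image_mset E_def Int_def vimage_def conj_commute)
  have card_E: "card (E \<rho>) < 3" for \<rho>
  proof -
    have "E \<rho> \<subseteq> {fst e, snd e}"
      by (auto simp: E_def edge_def min_def max_def split: if_splits)
    then have "card (E \<rho>) \<le> card {fst e, snd e}" by (intro card_mono) auto
    also have "\<dots> \<le> 2" by (simp add: card_insert_if)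
    finally show ?thesis by simp
  qed
  have value_R: "(\<Sum>i\<in>R \<rho>. A i (\<rho> i)) = perm_value n A \<rho> - real (card (E \<rho>)) * \<alpha>" if "\<rho> \<in> ?P" for \<rho>
  proof -
    have "perm_value n A \<rho> = (\<Sum>i\<in>E \<rho>. A i (\<rho> i)) + (\<Sum>i\<in>R \<rho>. A i (\<rho> i))"
      unfolding perm_value_def ER(1)[of \<rho>, symmetric] by (rule sum.union_disjoint[OF fin ER(2)])
    also have "(\<Sum>i\<in>E \<rho>. A i (\<rho> i)) = (\<Sum>i\<in>E \<rho>. \<alpha>)"
      using A_e range[OF that] by (intro sum.cong) (auto simp: E_def)
    finally show ?thesis by simp
  qed
  obtain N :: "nat \<times> nat \<Rightarrow> nat"
    where N: "inj_on (\<lambda>M. \<Sum>x\<in>#M. N x) {M. set_mset M \<subseteq> {..<n} \<times> {..<n} \<and> size M \<le> n}"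
    using ex_separating_weight[of "{..<n} \<times> {..<n}" n] by blast
  \<comment> \<open>The exponent of \<open>z\<close> contributed by the entries off
    \<open>e\<close>. Together with the exponent of \<open>x\<close> it gives the total weight,
    which identifies the monomial.\<close>
  define w where "w \<rho> = (\<Sum>i\<in>R \<rho>. N (edge i (\<rho> i)))" for \<rho>
  have edges_eq: "edges {..<n} \<rho> = edges {..<n} \<rho>'"
    if "\<rho> \<in> ?P" "\<rho>' \<in> ?P" "card (E \<rho>) = card (E \<rho>')" "w \<rho> = w \<rho>'" for \<rho> \<rho>'
  proof (rule inj_onD[OF N])
    have "(\<Sum>x\<in>#edges {..<n} \<rho>. N x) = card (E \<rho>) * N e + w \<rho>" for \<rho>
    proof -
      have "(\<Sum>x\<in>#edges {..<n} \<rho>. N x) = (\<Sum>i\<in>E \<rho>. N (edge i (\<rho> i))) + w \<rho>"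
        unfolding sum_eq_sum_edges[symmetric] w_def
        by (subst ER(1)[of \<rho>, symmetric]) (rule sum.union_disjoint[OF fin ER(2)])
      also have "(\<Sum>i\<in>E \<rho>. N (edge i (\<rho> i))) = (\<Sum>i\<in>E \<rho>. N e)"
        by (intro sum.cong) (auto simp: E_def)
      finally show ?thesis by simp
    qed
    then show "(\<Sum>x\<in>#edges {..<n} \<rho>. N x) = (\<Sum>x\<in>#edges {..<n} \<rho>'. N x)"
      using that(3,4) by simp
    have "edges {..<n} \<rho> \<in> {M. set_mset M \<subseteq> {..<n} \<times> {..<n} \<and> size M \<le> n}" if "\<rho> \<in> ?P" for \<rho>
      using range[OF that] by (auto simp: edges_def edge_def min_def max_def)
    then show "edges {..<n} \<rho> \<in> {M. set_mset M \<subseteq> {..<n} \<times> {..<n} \<and> size M \<le> n}"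
        "edges {..<n} \<rho>' \<in> {M. set_mset M \<subseteq> {..<n} \<times> {..<n} \<and> size M \<le> n}"
      using that(1,2) by blast+
  qed
  define C where "C k = {\<rho> \<in> ?P. card (E \<rho>) = k \<and> perm_value n A \<rho> = m}" for k
  have finC: "finite (C k)" for k using finP by (simp add: C_def)
  \<comment> \<open>The lowest possible coefficient of the \<open>x^k\<close> part of the
    determinant, as a polynomial in \<open>z\<close>. Equal exponents of \<open>z\<close> within
    \<open>C k\<close> come from equal monomials, hence equal signs, so no cancellation makes
    \<open>p k\<close> vanish.\<close>
  define p where "p k = (\<Sum>\<rho>\<in>C k. monom (of_int (sign \<rho>) :: complex) (w \<rho>))" for k
  have p_nonzero: "p k \<noteq> 0" if \<rho>: "\<rho> \<in> C k" for k \<rho>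
  proof
    assume "p k = 0"
    then have "0 = coeff (p k) (w \<rho>)" by simp
    also have "\<dots> = (\<Sum>\<rho>'\<in>C k. if w \<rho>' = w \<rho> then of_int (sign \<rho>') else 0)"
      by (simp add: p_def coeff_sum)
    also have "\<dots> = (\<Sum>\<rho>'\<in>{\<rho>' \<in> C k. w \<rho>' = w \<rho>}. of_int (sign \<rho>'))"
      using finC by (simp add: sum.inter_filter)
    also have "\<dots> \<noteq> 0"
    proof (rule sum_sign_nonzero)
      show "sign \<rho>' = sign \<rho>" if "\<rho>' \<in> {\<rho>' \<in> C k. w \<rho>' = w \<rho>}" for \<rho>'
        using that \<rho> edges_eq[of \<rho>' \<rho>] by (intro sign_eq_if_edges_eq[of "{..<n}"]) (auto simp: C_def)
    qed (use \<rho> finC in auto)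
    finally show False by simp
  qed
  let ?k = "card (E \<sigma>)" and ?l = "card (E \<tau>)"
  have "\<sigma> \<in> C ?k" "\<tau> \<in> C ?l" using \<sigma>\<tau> m by (auto simp: C_def m_def)
  \<comment> \<open>The factor \<open>[:0, 1:]\<close> forces \<open>z\<close> to be nonzero; a
    nonzero polynomial misses some complex number as a root.\<close>
  then have "[:0, 1:] * p ?k * p ?l \<noteq> 0" using p_nonzero by simp
  then have "finite {z. poly ([:0, 1:] * p ?k * p ?l) z = 0}" by (rule poly_roots_finite)
  then obtain z where "poly ([:0, 1:] * p ?k * p ?l) z \<noteq> 0"
    using infinite_UNIV_char_0[where ?'a = complex] by (metis (mono_tags, lifting) UNIV_eq_I mem_Collect_eq)
  then have z: "z \<noteq> 0" "poly (p ?k) z \<noteq> 0" "poly (p ?l) z \<noteq> 0" by auto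
  \<comment> \<open>The coefficient of \<open>x^k\<close> in the determinant of the matrix
    \<open>M\<close> built below.\<close>
  define a where "a k = (\<Sum>\<rho>\<in>{\<rho> \<in> ?P. card (E \<rho>) = k}.
      single (of_int (sign \<rho>) * z ^ w \<rho>) (perm_value n A \<rho> - real k * \<alpha>))" for k
  have deg_a: "deg_ge (cf (a k)) (m - real k * \<alpha>)" for k
    using m(2) unfolding deg_ge_def a_def cf_sum cf_single by (force intro!: sum.neutral)
  have lead_a: "cf (a k) (m - real k * \<alpha>) = poly (p k) z" for k
  proof -
    have "cf (a k) (m - real k * \<alpha>) = (\<Sum>\<rho>\<in>{\<rho> \<in> ?P. card (E \<rho>) = k}.
        if perm_value n A \<rho> = m then of_int (sign \<rho>) * z ^ w \<rho> else 0)"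
      unfolding a_def cf_sum cf_single by (intro sum.cong) auto
    also have "\<dots> = (\<Sum>\<rho>\<in>C k. of_int (sign \<rho>) * z ^ w \<rho>)"
      unfolding C_def using finP by (simp add: sum.inter_filter[symmetric] conj_assoc)
    finally show ?thesis by (simp add: p_def poly_sum poly_monom)
  qed
  \<comment> \<open>The choice of \<open>e\<close> makes the \<open>x\<close>-exponents of
    \<open>\<sigma>\<close> and \<open>\<tau>\<close> distinct, so they supply the two terms of
    minimal degree \<open>m\<close>.\<close>
  have "\<exists>x. deg_ge (cf x) \<alpha> \<and> cf x \<alpha> \<noteq> 0 \<and> (\<Sum>k<3. a k * x ^ k) = 0"
    using e z(2,3) by (intro quadratic_root_of_degree[OF deg_a card_E[of \<sigma>] card_E[of \<tau>]])
      (simp_all add: lead_a count_e)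
  then obtain x where x: "deg_ge (cf x) \<alpha>" "cf x \<alpha> \<noteq> 0" "(\<Sum>k<3. a k * x ^ k) = 0" by blast
  define M where "M i j = (if edge i j = e then x else single (z ^ N (edge i j)) (A i j))" for i j
  have lead_M: "deg_ge (cf (M i j)) (A i j)" "cf (M i j) (A i j) \<noteq> 0" if "i < n" "j < n" for i j
    using x(1,2) A_e[OF that] z(1) deg_ge_single by (auto simp: M_def cf_single)
  have "symmetric_lift n A (\<lambda>i j. cf (M i j))"
    unfolding symmetric_lift_def
  proof (intro allI impI conjI)
    fix i j assume ij: "i < n" "j < n"
    show "is_hahn (cf (M i j))" by (rule is_hahn_cf)
    show "cf (M i j) \<noteq> hahn_zero" using lead_M(2)[OF ij] by (auto simp: hahn_zero_def)
    show "cf (M i j) = cf (M j i)"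
      using A ij by (simp add: M_def edge_commute[of i j] sym_real_matrix_def)
    show "hahn_deg (cf (M i j)) = A i j"
      by (rule hahn_deg_eqI[OF lead_M[OF ij]])
  qed
  moreover have "hahn_det n (\<lambda>i j. cf (M i j)) = hahn_zero"
  proof -
    let ?T = "\<lambda>\<rho>. single (of_int (sign \<rho>) * z ^ w \<rho>) (perm_value n A \<rho> - real (card (E \<rho>)) * \<alpha>)"
    have "single (of_int (sign \<rho>)) 0 * (\<Prod>i<n. M i (\<rho> i)) = ?T \<rho> * x ^ card (E \<rho>)"
      if "\<rho> \<in> ?P" for \<rho>
    proof -
      have "(\<Prod>i<n. M i (\<rho> i)) = (\<Prod>i\<in>E \<rho>. x) * (\<Prod>i\<in>R \<rho>. single (z ^ N (edge i (\<rho> i))) (A i (\<rho> i)))"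
        unfolding M_def E_def R_def by (rule prod.If_cases) simp
      also have "\<dots> = x ^ card (E \<rho>) * single (z ^ w \<rho>) (perm_value n A \<rho> - real (card (E \<rho>)) * \<alpha>)"
        using value_R[OF that] fin by (simp add: single_prod w_def power_sum)
      finally show ?thesis
        by (simp add: mult_ac single_mult[of "of_int (sign \<rho>)" 0, simplified, symmetric])
    qed
    then have "(\<Sum>\<rho>\<in>?P. single (of_int (sign \<rho>)) 0 * (\<Prod>i<n. M i (\<rho> i)))
        = (\<Sum>\<rho>\<in>?P. ?T \<rho> * x ^ card (E \<rho>))"
      by (intro sum.cong refl) blast
    \<comment> \<open>Permutations are grouped by their exponent of \<open>x\<close>, which is 0, 1
      or 2.\<close>
    also have "\<dots> = (\<Sum>k<3. \<Sum>\<rho>\<in>{\<rho> \<in> ?P. card (E \<rho>) = k}. ?T \<rho> * x ^ card (E \<rho>))"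
      using card_E finP by (intro sum.group[symmetric]) auto
    also have "\<dots> = (\<Sum>k<3. a k * x ^ k)"
      unfolding a_def sum_distrib_right by (intro sum.cong) auto
    finally show ?thesis
      unfolding hahn_det_cf x(3) by (auto simp: hahn_zero_def cf_zero)
  qed
  ultimately show ?thesis by blast
qed

theorem theorem4:
  fixes n :: nat and A :: "nat \<Rightarrow> nat \<Rightarrow> real"
  assumes "n \<ge> 1" and "sym_real_matrix n A"
  shows "sym_trop_singular n A \<longleftrightarrow>
           (\<exists>L. symmetric_lift n A L \<and> hahn_det n L = hahn_zero)"
  using assms(2) singular_lift_if_sym_trop_singular sym_trop_singular_if_singular_lift by blast

end
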